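(* Consider the order-assignment model described in the context. In the case of undersupply, i.e. $N\le b$, for every $\alpha\in[0,1)$ with $\alpha N\in\mathbb{N}$ and every admissible threshold $\tau\ge r$, the benefit of freeriding $F(\alpha,\tau):=u^A(\alpha,\tau)-u^{\mathrm{base}}$ satisfies $$F(\alpha,\tau)=0 .$$
   Context: Model. Parameters: integers $N\ge1$ (workers) and $b\ge1$ (busy time); reals $r>0$ (base pay), $\delta>0$ (pay increment), $c,m\ge0$ (cost per mile, miles per order), $n>0$ (orders per hour); a threshold $\tau\ge r$ such that $Z:=(\tau-r)/\delta$ is a nonnegative integer (admissible threshold); a fraction $\alpha\in[0,1]$ with $\alpha N$ an integer. Exactly $\alpha N$ of the workers are participants, the other $(1-\alpha)N$ are non-participants. Dynamics. Time is discrete, with one incoming order per time step $t$. Each worker is idle or busy. If at least one worker is idle at step $t$, the order is offered, at pay $r$, to a uniformly random idle worker. A non-participant accepts at any pay; a participant accepts iff the current pay is at least $\tau$ and otherwise declines. After each decline the pay rises by $\delta$ and the order is offered again to an independently, uniformly chosen idle worker (possibly the same one), within the same time step, until accepted. A worker accepting the order of step $t$ is busy for $b$ time steps: unavailable for the orders of steps $t+1,\dots,t+b-1$ and idle again for the order of step $t+b$. If no worker is idle at step $t$, the order of step $t$ is lost. The process starts from an arbitrary fixed initial configuration (every initially busy worker becoming idle within $b$ steps). Let $I_t=1$ if some worker is idle at step $t$ and $I_t=0$ otherwise. When $I_t=1$, let $q_t$ be the fraction of participants among the workers idle at step $t$ (before assignment), and let $\beta_t:=q_t^{Z+1}$, the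 conditional probability that a participant accepts the order. For $q_t<1$ let $$R_t:=\sum_{z=0}^{Z} z\delta\,\frac{q_t^z(1-q_t)}{1-q_t^{Z+1}},$$ the expected pay increase over $r$ given that a non-participant accepts; the product $(1-\beta_t)R_t$ is read as $0$ when $q_t=1$. Any product containing the factor $I_t$ is $0$ when $I_t=0$. For a quantity $X_t$ depending on the state at step $t$, $\mathbb{E}_t[X_t]:=\lim_{T\to\infty}\frac1T\sum_{t=1}^T\mathbb{E}[X_t]$ (long-run average). Put $R:=\mathbb{E}_t[(1-\beta_t)R_tI_t]$. Utility (expected hourly income) of a non-participant, for $\alpha<1$: $$u^A(\alpha,\tau):=\frac{1}{(1-\alpha)N}(r-cm)\,n\,\mathbb{E}_t[(1-\beta_t)I_t]+\frac{n}{(1-\alpha)N}R .$$ The base utility $u^{\mathrm{base}}$ is the average utility per worker in the same model without any strategy, i.e. with $\alpha=0$ (every worker accepts every offered order at pay $r$): $u^{\mathrm{base}}=\frac1N(r-cm)\,n\,\mathbb{E}_t[I_t]$, with $\mathbb{E}_t[I_t]$ computed for $\alpha=0$. *)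

theory Defs
  imports "HOL-Probability.Probability"
begin

text \<open>
  The workers are the numbers below \<open>N\<close>. A configuration \<open>s\<close> assigns to each worker the number of
  steps until it is idle, as seen by the next incoming order; so \<open>s w = 0\<close> means that \<open>w\<close> is idle.
  The set \<open>P\<close> of participants and the initial configuration are arguments of the definitions rather
  than parameters of the locale, because the base utility refers to the same model with \<open>P = {}\<close>.
\<close>

type_synonym configuration = "nat \<Rightarrow> nat"

locale order_assignment =
  fixes N b :: nat and r \<delta> c m n \<tau> :: real
  assumes N_ge_1: "N \<ge> 1"
    and b_ge_1: "b \<ge> 1"
    and r_pos: "r > 0"
    and \<delta>_pos: "\<delta> > 0"
    and c_nonneg: "c \<ge> 0"
    and m_nonneg: "m \<ge> 0"
    and n_pos: "n > 0"
    and \<tau>_ge_r: "\<tau> \<ge> r"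
    and \<tau>_admissible: "(\<tau> - r) / \<delta> \<in> \<nat>"
begin

definition Z :: nat where
  "Z = nat \<lfloor>(\<tau> - r) / \<delta>\<rfloor>"

definition idle :: "configuration \<Rightarrow> nat set" where
  "idle s = {w. w < N \<and> s w = 0}"

definition accepts :: "nat set \<Rightarrow> nat \<Rightarrow> real \<Rightarrow> bool" where
  "accepts P w pay \<longleftrightarrow> (w \<in> P \<longrightarrow> \<tau> \<le> pay)"

text \<open>
  \<open>offer P A pay\<close> is the distribution of the worker who finally accepts an order that is currently
  offered at \<open>pay\<close>, where \<open>A\<close> is the nonempty set of idle workers.
\<close>

function offer :: "nat set \<Rightarrow> nat set \<Rightarrow> real \<Rightarrow> nat pmf" where
  "offer P A pay =
     bind_pmf (pmf_of_set A)
       (\<lambda>w. if accepts P w pay then return_pmf w else offer P A (pay + \<delta>))"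
  by pat_completeness auto
termination
proof (relation "Wellfounded.measure (\<lambda>(P, A, pay). nat \<lceil>(\<tau> - pay) / \<delta>\<rceil>)")
  fix P A pay and w :: nat
  assume "\<not> accepts P w pay"
  then have "0 < (\<tau> - pay) / \<delta>"
    using \<delta>_pos by (auto simp: accepts_def)
  moreover have "(\<tau> - (pay + \<delta>)) / \<delta> = (\<tau> - pay) / \<delta> - 1"
    using \<delta>_pos by (simp add: field_simps)
  ultimately show "((P, A, pay + \<delta>), (P, A, pay)) \<in> Wellfounded.measure (\<lambda>(P, A, pay). nat \<lceil>(\<tau> - pay) / \<delta>\<rceil>)"
    by (simp add: ceiling_diff_one)
qed simp

declare offer.simps [simp del]

definition tick :: "configuration \<Rightarrow> configuration" where
  "tick s = (\<lambda>w. s w - 1)"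

text \<open>
  A worker accepting the order of step \<open>t\<close> has \<open>b - 1\<close> remaining steps when the order of step
  \<open>t + 1\<close> arrives, and hence is idle again for the order of step \<open>t + b\<close>.
\<close>

definition step :: "nat set \<Rightarrow> configuration \<Rightarrow> configuration pmf" where
  "step P s =
     (if idle s = {} then return_pmf (tick s)
      else map_pmf (\<lambda>w. tick (s(w := b))) (offer P (idle s) r))"

text \<open>
  \<open>config P s\<^sub>0 t\<close> is the distribution of the configuration after \<open>t\<close> orders, that is, the one
  faced by the order of step \<open>t + 1\<close>.
\<close>

primrec config :: "nat set \<Rightarrow> configuration \<Rightarrow> nat \<Rightarrow> configuration pmf" where
  "config P s\<^sub>0 0 = return_pmf s\<^sub>0"
| "config P s\<^sub>0 (Suc t) = bind_pmf (config P s\<^sub>0 t) (step P)"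

definition time_average :: "nat set \<Rightarrow> configuration \<Rightarrow> (configuration \<Rightarrow> real) \<Rightarrow> nat \<Rightarrow> real" where
  "time_average P s\<^sub>0 X T =
     1 / real T * (\<Sum>t = 1..T. measure_pmf.expectation (config P s\<^sub>0 (t - 1)) X)"

definition long_run_average :: "nat set \<Rightarrow> configuration \<Rightarrow> (configuration \<Rightarrow> real) \<Rightarrow> real" where
  "long_run_average P s\<^sub>0 X = lim (time_average P s\<^sub>0 X)"

definition idle_indicator :: "configuration \<Rightarrow> real" where
  "idle_indicator s = (if idle s = {} then 0 else 1)"

definition q :: "nat set \<Rightarrow> configuration \<Rightarrow> real" where
  "q P s = real (card (idle s \<inter> P)) / real (card (idle s))"

definition \<beta> :: "nat set \<Rightarrow> configuration \<Rightarrow> real" where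
  "\<beta> P s = q P s ^ (Z + 1)"

text \<open>
  For \<open>q P s = 1\<close> every summand is \<open>0 / 0 = 0\<close>; the value is then irrelevant, as it is only used
  multiplied by \<open>1 - \<beta> P s = 0\<close>.
\<close>

definition pay_increase :: "nat set \<Rightarrow> configuration \<Rightarrow> real" where
  "pay_increase P s =
     (\<Sum>z = 0..Z. real z * \<delta> * (q P s ^ z * (1 - q P s) / (1 - q P s ^ (Z + 1))))"

definition nonparticipant_service :: "nat set \<Rightarrow> configuration \<Rightarrow> real" where
  "nonparticipant_service P s = (1 - \<beta> P s) * idle_indicator s"

definition nonparticipant_gain :: "nat set \<Rightarrow> configuration \<Rightarrow> real" where
  "nonparticipant_gain P s = (1 - \<beta> P s) * pay_increase P s * idle_indicator s"

text \<open>The parameter \<open>\<alpha>\<close> is meant to satisfy \<open>card P = \<alpha> * N\<close>.\<close>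

definition utility_nonparticipant :: "real \<Rightarrow> nat set \<Rightarrow> configuration \<Rightarrow> real" where
  "utility_nonparticipant \<alpha> P s\<^sub>0 =
     1 / ((1 - \<alpha>) * real N) * (r - c * m) * n * long_run_average P s\<^sub>0 (nonparticipant_service P)
     + n / ((1 - \<alpha>) * real N) * long_run_average P s\<^sub>0 (nonparticipant_gain P)"

definition utility_base :: "configuration \<Rightarrow> real" where
  "utility_base s\<^sub>0 = 1 / real N * (r - c * m) * n * long_run_average {} s\<^sub>0 idle_indicator"

text \<open>The two processes being compared may start from different configurations.\<close>

definition freeriding_benefit ::
    "real \<Rightarrow> nat set \<Rightarrow> configuration \<Rightarrow> configuration \<Rightarrow> real" where
  "freeriding_benefit \<alpha> P s\<^sub>0 s\<^sub>0' = utility_nonparticipant \<alpha> P s\<^sub>0 - utility_base s\<^sub>0'"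

text \<open>
  \<^const>\<open>lim\<close> is total, so the existence of the limits behind \<open>freeriding_benefit\<close> is a property
  of its own.
\<close>

definition freeriding_benefit_defined :: "nat set \<Rightarrow> configuration \<Rightarrow> configuration \<Rightarrow> bool" where
  "freeriding_benefit_defined P s\<^sub>0 s\<^sub>0' \<longleftrightarrow>
     convergent (time_average P s\<^sub>0 (nonparticipant_service P)) \<and>
     convergent (time_average P s\<^sub>0 (nonparticipant_gain P)) \<and>
     convergent (time_average {} s\<^sub>0' idle_indicator)"

end

end

theory Submission
  imports Defs
begin

text \<open>
  Once all initially busy workers have become idle, at most one worker becomes idle per step, so the
  number of idle workers never increases above one again after it has been at most one; as
  \<open>N \<le> b\<close>, it cannot stay above one for \<open>b\<close> consecutive steps. From then on every order is
  accepted by the only idle worker, if there is one, so there is no freeriding gain, and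
  for every set \<open>V\<close> of workers the total remaining busy time of \<open>V\<close> changes
  by \<open>b\<close> times the number of orders served by \<open>V\<close> minus \<open>card V\<close>.
  Since this total is bounded, \<open>V\<close> serves orders at rate \<open>card V / b\<close>, whatever \<open>P\<close> is.
\<close>

section \<open>Time averages of sequences with bounded drift\<close>

text \<open>Summing the drift telescopes \<open>f\<close>, so \<open>B\<close> times the sum of
  \<open>a\<close> is \<open>T * v\<close> up to a bounded error, which vanishes after division by
  \<open>T\<close>.\<close>

lemma average_tendsto_if_bounded_drift:
  fixes a f :: "nat \<Rightarrow> real"
  assumes B: "B > 0"
    and drift: "\<And>t. t \<ge> t\<^sub>0 \<Longrightarrow> B * a t = v + f (Suc t) - f t"
    and bounded: "\<And>t. \<bar>f t\<bar> \<le> M"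
  shows "(\<lambda>T. 1 / real T * (\<Sum>t = 1..T. a (t - 1))) \<longlonglongrightarrow> v / B"
proof -
  \<comment> \<open>\<open>D\<close> is this error without \<open>f T\<close>; it is frozen from
    \<open>t\<^sub>0\<close> on and absorbs the arbitrary early terms.\<close>
  define D where "D T = B * (\<Sum>t<T. a t) - real T * v - f T" for T
  have D_const: "D T = D t\<^sub>0" if "T \<ge> t\<^sub>0" for T
    using that
  proof (induction T rule: dec_induct)
    case (step T)
    then show ?case
      using drift[of T] by (simp add: D_def algebra_simps)
  qed simp
  have "(\<lambda>T. (f T + D t\<^sub>0) / B * (1 / real T)) \<longlonglongrightarrow> 0"
  proof (rule real_tendsto_sandwich)
    have "\<bar>f T + D t\<^sub>0\<bar> \<le> M + \<bar>D t\<^sub>0\<bar>" for T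
      using bounded[of T] by linarith
    then have "\<bar>(f T + D t\<^sub>0) / B\<bar> \<le> (M + \<bar>D t\<^sub>0\<bar>) / B" for T
      using B by (simp add: abs_divide divide_right_mono)
    then have "\<bar>(f T + D t\<^sub>0) / B * (1 / real T)\<bar> \<le> (M + \<bar>D t\<^sub>0\<bar>) / B * (1 / real T)" for T
      unfolding abs_mult by (intro mult_mono') simp_all
    then have bnd: "- ((M + \<bar>D t\<^sub>0\<bar>) / B * (1 / real T)) \<le> (f T + D t\<^sub>0) / B * (1 / real T)"
      "(f T + D t\<^sub>0) / B * (1 / real T) \<le> (M + \<bar>D t\<^sub>0\<bar>) / B * (1 / real T)" for T
      unfolding abs_le_iff using minus_le_iff by blast+
    show "\<forall>\<^sub>F T in sequentially. - ((M + \<bar>D t\<^sub>0\<bar>) / B * (1 / real T)) \<le> (f T + D t\<^sub>0) / B * (1 / real T)"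
      by (intro always_eventually allI bnd)
    show "\<forall>\<^sub>F T in sequentially. (f T + D t\<^sub>0) / B * (1 / real T) \<le> (M + \<bar>D t\<^sub>0\<bar>) / B * (1 / real T)"
      by (intro always_eventually allI bnd)
    have lim: "(\<lambda>T. (M + \<bar>D t\<^sub>0\<bar>) / B * (1 / real T)) \<longlonglongrightarrow> 0"
      by (rule tendsto_mult_right_zero[OF lim_1_over_n])
    then show "(\<lambda>T. (M + \<bar>D t\<^sub>0\<bar>) / B * (1 / real T)) \<longlonglongrightarrow> 0" .
    show "(\<lambda>T. - ((M + \<bar>D t\<^sub>0\<bar>) / B * (1 / real T))) \<longlonglongrightarrow> 0"
      using tendsto_minus[OF lim] by simp
  qed
  from tendsto_add[OF tendsto_const this]
  have "(\<lambda>T. v / B + (f T + D t\<^sub>0) / B * (1 / real T)) \<longlonglongrightarrow> v / B"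
    by simp
  then show ?thesis
  proof (rule Lim_transform_eventually)
    \<comment> \<open>\<open>T = 0\<close> is excluded because \<open>1 / real 0 = 0\<close> would
      drop the term \<open>v / B\<close>.\<close>
    have "v / B + (f T + D t\<^sub>0) / B * (1 / real T) = 1 / real T * (\<Sum>t = 1..T. a (t - 1))"
      if "T \<ge> max 1 t\<^sub>0" for T
    proof -
      have "B * (\<Sum>t<T. a t) = real T * v + f T + D t\<^sub>0"
        using D_const[of T] that by (simp add: D_def)
      moreover have "(\<Sum>t = 1..T. a (t - 1)) = (\<Sum>t<T. a t)"
        by (rule sum.reindex_bij_witness[of _ Suc "\<lambda>t. t - 1"]) auto
      ultimately have sum: "(\<Sum>t = 1..T. a (t - 1)) = (real T * v + f T + D t\<^sub>0) / B"
        using B by (simp add: field_simps)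
      show ?thesis
        unfolding sum using that B by (simp add: field_simps)
    qed
    then show "\<forall>\<^sub>F T in sequentially.
        v / B + (f T + D t\<^sub>0) / B * (1 / real T) = 1 / real T * (\<Sum>t = 1..T. a (t - 1))"
      unfolding eventually_sequentially by blast
  qed
qed

context order_assignment
begin

section \<open>Support and expectations of the chain\<close>

lemma finite_idle: "finite (idle s)"
  by (simp add: idle_def)

text \<open>The dynamics below use no other fact about the negotiation: whoever accepts was
  idle.\<close>

lemma set_pmf_offer:
  assumes "finite A" "A \<noteq> {}"
  shows "set_pmf (offer P A pay) \<subseteq> A"
  using assms
proof (induction P A pay rule: offer.induct)
  case (1 P A pay)
  have "set_pmf (if accepts P w pay then return_pmf w else offer P A (pay + \<delta>)) \<subseteq> A"
    if "w \<in> A" for w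
    using 1 that by auto
  then show ?case
    using 1(2,3) by (subst offer.simps) auto
qed

lemma step_cases:
  assumes "s' \<in> set_pmf (step P s)"
  obtains (lost) "idle s = {}" "s' = tick s"
    | (accepted) w where "w \<in> idle s" "s' = tick (s(w := b))"
proof (cases "idle s = {}")
  case True
  then show ?thesis using assms lost by (simp add: step_def)
next
  case False
  then show ?thesis
    using assms accepted set_pmf_offer[OF finite_idle False] by (auto simp: step_def)
qed

lemma finite_set_pmf_step: "finite (set_pmf (step P s))"
proof (rule finite_subset)
  show "set_pmf (step P s) \<subseteq> insert (tick s) ((\<lambda>w. tick (s(w := b))) ` idle s)"
    by (auto elim: step_cases)
qed (simp add: finite_idle)

text \<open>Finite support makes every real function of the configuration integrable.\<close>

lemma finite_set_pmf_config: "finite (set_pmf (config P s\<^sub>0 t))"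
  by (induction t) (auto simp: finite_set_pmf_step)

lemma expectation_config_Suc:
  fixes f :: "configuration \<Rightarrow> real"
  shows "measure_pmf.expectation (config P s\<^sub>0 (Suc t)) f =
    measure_pmf.expectation (config P s\<^sub>0 t) (\<lambda>s. measure_pmf.expectation (step P s) f)"
proof -
  let ?A = "set_pmf (config P s\<^sub>0 t)"
  have "measure_pmf.expectation (config P s\<^sub>0 (Suc t)) f =
      (\<Sum>s\<in>?A. pmf (config P s\<^sub>0 t) s *\<^sub>R measure_pmf.expectation (step P s) f)"
    unfolding config.simps
    by (rule pmf_expectation_bind) (auto simp: finite_set_pmf_config finite_set_pmf_step)
  also have "\<dots> = measure_pmf.expectation (config P s\<^sub>0 t) (\<lambda>s. measure_pmf.expectation (step P s) f)"
    by (rule integral_measure_pmf[symmetric])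
      (auto simp: finite_set_pmf_config)
  finally show ?thesis .
qed

section \<open>Reaching at most one idle worker\<close>

text \<open>
  After \<open>t\<close> steps two workers can only have the same remaining busy time if both are idle or
  have been busy from the start, in which case it is at most \<open>b - t\<close> (truncated subtraction).
\<close>

definition separated :: "nat \<Rightarrow> configuration \<Rightarrow> bool" where
  "separated t s \<longleftrightarrow> (\<forall>w<N. s w \<le> b \<and> (0 < t \<longrightarrow> s w < b)) \<and>
     (\<forall>w<N. \<forall>w'<N. w \<noteq> w' \<longrightarrow> s w = s w' \<longrightarrow> s w \<le> b - t)"

lemma separated_le: "separated t s \<Longrightarrow> w < N \<Longrightarrow> s w \<le> b"
  by (simp add: separated_def)

lemma separated_less: "separated t s \<Longrightarrow> 0 < t \<Longrightarrow> w < N \<Longrightarrow> s w < b"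
  by (simp add: separated_def)

lemma separated_eq:
  "separated t s \<Longrightarrow> w < N \<Longrightarrow> w' < N \<Longrightarrow> w \<noteq> w' \<Longrightarrow> s w = s w' \<Longrightarrow> s w \<le> b - t"
  by (simp add: separated_def)

text \<open>A tick lowers a common positive value together with the bound \<open>b - t\<close>, so
  only the fresh value \<open>b - 1\<close> of the accepting worker could cause a new
  coincidence.\<close>

lemma separated_step:
  assumes sep: "separated t s" and s': "s' \<in> set_pmf (step P s)"
  shows "separated (Suc t) s'"
  using s'
proof (cases rule: step_cases)
  case lost
  have s': "s' w = s w - 1" for w
    by (simp add: lost tick_def)
  have "s' w < b" if "w < N" for w
    using separated_le[OF sep that] b_ge_1 unfolding s' by linarith
  moreover have "s' w \<le> b - Suc t" if "w < N" "w' < N" "w \<noteq> w'" "s' w = s' w'" for w w'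
    using separated_eq[OF sep that(1-3)] that(4) unfolding s' by linarith
  ultimately show ?thesis
    unfolding separated_def by (auto intro: less_imp_le)
next
  case (accepted x)
  have x: "x < N" "s x = 0"
    using accepted(1) by (auto simp: idle_def)
  have s': "s' w = (if w = x then b - 1 else s w - 1)" for w
    by (simp add: accepted(2) tick_def)
  have less: "s' w < b" if "w < N" for w
    using separated_le[OF sep that] b_ge_1 by (auto simp: s')
  \<comment> \<open>For \<open>t > 0\<close> all values are below \<open>b\<close> before the tick,
    so a match with \<open>b - 1\<close> forces \<open>b = 1\<close>, where it is 0; for
    \<open>t = 0\<close> the bound is \<open>b - 1\<close> itself.\<close>
  have new: "b - 1 \<le> b - Suc t" if "w < N" "s w - 1 = b - 1" for w
    using separated_le[OF sep that(1)] separated_less[OF sep _ that(1)] that(2) b_ge_1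
    by (cases "t = 0") auto
  have "s' w \<le> b - Suc t" if "w < N" "w' < N" "w \<noteq> w'" "s' w = s' w'" for w w'
  proof (cases "w = x \<or> w' = x")
    case True
    then show ?thesis using that new[of w] new[of w'] by (auto simp: s')
  next
    case False
    then show ?thesis using separated_eq[OF sep that(1-3)] that(4) by (simp add: s') linarith
  qed
  with less show ?thesis
    unfolding separated_def by (auto intro: less_imp_le)
qed

lemma separated_config:
  assumes "\<forall>w<N. s\<^sub>0 w \<le> b" "s \<in> set_pmf (config P s\<^sub>0 t)"
  shows "separated t s"
  using assms(2)
proof (induction t arbitrary: s)
  case 0
  then show ?case using assms(1) by (auto simp: separated_def)
next
  case (Suc t)
  then show ?case by (auto intro: separated_step)
qed

text \<open>Two workers idle afterwards would both have had remaining time 1 before, which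
  separation forbids once \<open>b - t = 0\<close>.\<close>

lemma card_idle_le_1_step:
  assumes "N \<le> b" and sep: "separated t s" "t \<ge> b"
    and s': "s' \<in> set_pmf (step P s)" and idle: "card (idle s) \<le> 1"
  shows "card (idle s') \<le> 1"
proof -
  have *: "w = w'" if "w \<in> idle s'" "w' \<in> idle s'" for w w'
  proof (rule ccontr)
    assume "w \<noteq> w'"
    \<comment> \<open>Two distinct workers and \<open>N \<le> b\<close> give \<open>b > 1\<close>,
      so the worker who has just accepted is not idle again after the tick.\<close>
    with that \<open>N \<le> b\<close> have w: "w < N" "w' < N" "b > 1"
      by (auto simp: idle_def)
    have idle_eq: "y = y'" if "y \<in> idle s" "y' \<in> idle s" for y y'
      using idle that card_le_Suc0_iff_eq[OF finite_idle] by auto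
    have "s y = 1" if y: "y \<in> idle s'" "y < N" for y
      using s'
    proof (cases rule: step_cases)
      case lost
      then have "y \<notin> idle s" by simp
      then show ?thesis using y lost(2) by (simp add: idle_def tick_def)
    next
      case (accepted x)
      have "y \<noteq> x"
        using y(1) accepted(2) \<open>b > 1\<close> by (auto simp: idle_def tick_def)
      then have "y \<notin> idle s"
        using idle_eq accepted(1) by blast
      then show ?thesis using y \<open>y \<noteq> x\<close> accepted(2) by (simp add: idle_def tick_def)
    qed
    with that w have "s w = 1" "s w' = 1" by auto
    then show False
      using separated_eq[OF sep(1) w(1,2) \<open>w \<noteq> w'\<close>] sep(2) by simp
  qed
  then show ?thesis
    using card_le_Suc0_iff_eq[OF finite_idle] by auto
qed

text \<open>
  As long as at least two workers are idle, no order is lost, and the workers who accepted the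
  last \<open>j\<close> orders occupy the \<open>j\<close> largest remaining busy times.
\<close>

definition saturated :: "nat \<Rightarrow> configuration \<Rightarrow> bool" where
  "saturated j s \<longleftrightarrow> card (idle s) \<le> 1 \<or> (\<forall>v. 0 < v \<and> b - j \<le> v \<and> v < b \<longrightarrow> (\<exists>w<N. s w = v))"

lemma saturated_step:
  assumes "N \<le> b" and sep: "separated t s" "t \<ge> b"
    and s': "s' \<in> set_pmf (step P s)" and sat: "saturated j s"
  shows "saturated (Suc j) s'"
proof (cases "card (idle s) \<le> 1")
  case True
  then show ?thesis
    using card_idle_le_1_step[OF assms(1) sep s'] by (simp add: saturated_def)
next
  case False
  then have taken: "\<exists>w<N. s w = v" if "0 < v" "b - j \<le> v" "v < b" for v
    using sat that by (auto simp: saturated_def)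
  from False have "idle s \<noteq> {}" by auto
  with s' obtain x where x: "x \<in> idle s" "s' = tick (s(x := b))"
    by (auto elim: step_cases)
  have "\<exists>w<N. s' w = v" if v: "0 < v" "b - Suc j \<le> v" "v < b" for v
  proof (cases "v = b - 1")
    case True
    then show ?thesis using x by (intro exI[of _ x]) (auto simp: idle_def tick_def)
  next
    case False
    then have "Suc v < b" "b - j \<le> Suc v"
      using v by linarith+
    then obtain w where "w < N" "s w = Suc v"
      using taken[of "Suc v"] by auto
    then show ?thesis using x by (intro exI[of _ w]) (auto simp: idle_def tick_def)
  qed
  then show ?thesis by (auto simp: saturated_def)
qed

text \<open>Otherwise the values from 1 to \<open>b - 1\<close> are all taken, by
  \<open>b - 1\<close> different busy workers, which leaves at most
  \<open>N - (b - 1) \<le> 1\<close> idle.\<close>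

lemma card_idle_le_1_if_saturated:
  assumes "N \<le> b" "saturated b s"
  shows "card (idle s) \<le> 1"
proof (rule ccontr)
  assume *: "\<not> card (idle s) \<le> 1"
  then have "{0<..<b} \<subseteq> s ` ({..<N} - idle s)"
    using assms(2) by (fastforce simp: saturated_def idle_def)
  then have "card {0<..<b} \<le> card ({..<N} - idle s)"
    by (rule surj_card_le[rotated]) simp
  moreover have "card ({..<N} - idle s) = N - card (idle s)"
    by (subst card_Diff_subset) (auto simp: finite_idle idle_def)
  moreover have "card (idle s) \<le> N"
    using card_mono[of "{..<N}" "idle s"] by (auto simp: idle_def)
  ultimately show False using * assms(1) b_ge_1 by simp
qed

lemma card_idle_config_le_1:
  assumes "N \<le> b" "\<forall>w<N. s\<^sub>0 w \<le> b" "t \<ge> 2 * b" "s \<in> set_pmf (config P s\<^sub>0 t)"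
  shows "card (idle s) \<le> 1"
proof -
  \<comment> \<open>The count \<open>j\<close> starts at time \<open>b\<close>, when separation has
    become strict; for \<open>j = 0\<close> the range of \<open>v\<close> is empty.\<close>
  have sat: "saturated j s" if "s \<in> set_pmf (config P s\<^sub>0 (b + j))" for j s
    using that
  proof (induction j arbitrary: s)
    case 0
    then show ?case by (auto simp: saturated_def)
  next
    case (Suc j)
    then obtain s' where "s' \<in> set_pmf (config P s\<^sub>0 (b + j))" "s \<in> set_pmf (step P s')"
      by auto
    then show ?case
      using Suc.IH saturated_step[OF assms(1) separated_config[OF assms(2)]] by simp
  qed
  show ?thesis
    using assms(3,4)
  proof (induction t arbitrary: s rule: dec_induct)
    case base
    then show ?case
      using card_idle_le_1_if_saturated[OF assms(1) sat] by (simp add: mult_2)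
  next
    case (step t)
    then obtain s' where "s' \<in> set_pmf (config P s\<^sub>0 t)" "s \<in> set_pmf (step P s')"
      by auto
    then show ?case
      using step card_idle_le_1_step[OF assms(1) separated_config[OF assms(2)]] by simp
  qed
qed

section \<open>Service and gain with at most one idle worker\<close>

lemma card_idle_le_1_cases:
  assumes "card (idle s) \<le> 1"
  obtains "idle s = {}" | x where "idle s = {x}"
  using assms finite_idle[of s] card_1_singletonE by (metis card_eq_0_iff le_neq_implies_less less_one)

lemma nonparticipant_service_singleton:
  assumes "idle s = {x}"
  shows "nonparticipant_service P s = (if x \<in> P then 0 else 1)"
  using assms by (simp add: nonparticipant_service_def idle_indicator_def \<beta>_def q_def)

lemma nonparticipant_gain_eq_0:
  assumes "card (idle s) \<le> 1"
  shows "nonparticipant_gain P s = 0"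
  using assms
proof (cases rule: card_idle_le_1_cases)
  case 1
  then show ?thesis by (simp add: nonparticipant_gain_def idle_indicator_def)
next
  case (2 x)
  show ?thesis
  proof (cases "x \<in> P")
    case True
    with 2 show ?thesis by (simp add: nonparticipant_gain_def \<beta>_def q_def)
  next
    case False
    with 2 have "q P s = 0" by (simp add: q_def)
    \<comment> \<open>For \<open>z > 0\<close> the power of \<open>q P s = 0\<close> vanishes, and
      for \<open>z = 0\<close> the factor \<open>z\<close> does.\<close>
    then have "pay_increase P s = 0"
      unfolding pay_increase_def by (intro sum.neutral) (auto simp: power_0_left)
    then show ?thesis by (simp add: nonparticipant_gain_def)
  qed
qed

lemma nonparticipant_service_empty: "nonparticipant_service {} = idle_indicator"
  by (auto simp: fun_eq_iff nonparticipant_service_def \<beta>_def q_def)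

section \<open>Workload balance and long-run averages\<close>

definition workload :: "nat set \<Rightarrow> configuration \<Rightarrow> real" where
  "workload V s = (\<Sum>w\<in>V. real (s w))"

text \<open>With at most one idle worker the step is deterministic, and the truncated subtraction in
  \<open>tick\<close> is harmless: it meets only busy workers and the one who has just received
  \<open>b\<close>.\<close>

lemma workload_step:
  assumes "card (idle s) \<le> 1" "s' \<in> set_pmf (step P s)"
  defines "V \<equiv> {..<N} - P"
  shows "workload V s' = workload V s + real b * nonparticipant_service P s - real (card V)"
  using assms(1)
proof (cases rule: card_idle_le_1_cases)
  case 1
  then have "s' = tick s"
    using assms(2) by (auto elim: step_cases)
  moreover have "s w > 0" if "w \<in> V" for w
    using 1 that by (auto simp: idle_def V_def)
  ultimately have "workload V s' = (\<Sum>w\<in>V. real (s w) - 1)"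
    unfolding workload_def by (intro sum.cong) (auto simp: tick_def of_nat_diff Suc_le_eq)
  then show ?thesis
    using 1 by (simp add: workload_def sum_subtractf nonparticipant_service_def idle_indicator_def)
next
  case (2 x)
  then have s': "s' = tick (s(x := b))"
    using assms(2) by (auto elim: step_cases)
  have x: "x < N" "s x = 0" "\<And>w. w \<in> V \<Longrightarrow> w \<noteq> x \<Longrightarrow> s w > 0"
  proof -
    have mem: "w \<in> idle s \<longleftrightarrow> w = x" for w using 2 by simp
    show "x < N" "s x = 0" using mem[of x] by (simp_all add: idle_def)
    show "s w > 0" if "w \<in> V" "w \<noteq> x" for w
      using mem[of w] that by (simp add: idle_def V_def)
  qed
  \<comment> \<open>The accepting worker fits the pattern too: its new value is
    \<open>0 - 1 + b\<close>.\<close>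
  have "workload V s' = (\<Sum>w\<in>V. real (s w) - 1 + (if w = x then real b else 0))"
    unfolding workload_def s'
    using x b_ge_1 by (intro sum.cong) (auto simp: tick_def of_nat_diff Suc_le_eq)
  also have "\<dots> = workload V s - real (card V) + (if x \<in> V then real b else 0)"
    by (simp add: workload_def sum.distrib sum_subtractf V_def)
  finally show ?thesis
    using nonparticipant_service_singleton[OF 2] x by (simp add: V_def)
qed

lemma expectation_workload_le:
  assumes "V \<subseteq> {..<N}" and init: "\<forall>w<N. s\<^sub>0 w \<le> b"
  shows "\<bar>measure_pmf.expectation (config P s\<^sub>0 t) (workload V)\<bar> \<le> real N * real b"
proof -
  have bounds: "0 \<le> workload V s" "workload V s \<le> real N * real b"
    if "s \<in> set_pmf (config P s\<^sub>0 t)" for s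
  proof -
    show "0 \<le> workload V s" by (simp add: workload_def sum_nonneg)
    have "workload V s \<le> (\<Sum>w<N. real (s w))"
      unfolding workload_def using assms(1) by (intro sum_mono2) auto
    also have "\<dots> \<le> real N * real b"
      using sum_bounded_above[of "{..<N}" "\<lambda>w. real (s w)" "real b"]
        separated_le[OF separated_config[OF init that]] by simp
    finally show "workload V s \<le> real N * real b" .
  qed
  have int: "integrable (measure_pmf (config P s\<^sub>0 t)) (workload V)"
    by (rule integrable_measure_pmf_finite[OF finite_set_pmf_config])
  have "0 \<le> measure_pmf.expectation (config P s\<^sub>0 t) (workload V)"
    by (rule integral_nonneg_AE) (simp add: AE_measure_pmf_iff bounds)
  moreover have "measure_pmf.expectation (config P s\<^sub>0 t) (workload V) \<le> real N * real b"
    by (rule measure_pmf.integral_le_const[OF int]) (simp add: AE_measure_pmf_iff bounds)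
  ultimately show ?thesis by simp
qed

text \<open>In expectation, the workload balance is a drift identity valid from \<open>2 * b\<close>
  on, with the bounded expected workload as \<open>f\<close>.\<close>

lemma time_average_service_tendsto:
  assumes "N \<le> b" "\<forall>w<N. s\<^sub>0 w \<le> b"
  shows "time_average P s\<^sub>0 (nonparticipant_service P) \<longlonglongrightarrow> real (card ({..<N} - P)) / real b"
proof -
  let ?V = "{..<N} - P"
  let ?E = "\<lambda>t. measure_pmf.expectation (config P s\<^sub>0 t)"
  have drift: "real b * ?E t (nonparticipant_service P) =
      real (card ?V) + ?E (Suc t) (workload ?V) - ?E t (workload ?V)" if "t \<ge> 2 * b" for t
  proof -
    note int = integrable_measure_pmf_finite[OF finite_set_pmf_config]
    have "measure_pmf.expectation (step P s) (workload ?V) =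
        workload ?V s + real b * nonparticipant_service P s - real (card ?V)"
      if s: "s \<in> set_pmf (config P s\<^sub>0 t)" for s
    proof -
      have "measure_pmf.expectation (step P s) (workload ?V) = measure_pmf.expectation (step P s)
          (\<lambda>_. workload ?V s + real b * nonparticipant_service P s - real (card ?V))"
        by (rule integral_cong_AE)
          (auto simp: AE_measure_pmf_iff
            intro!: workload_step card_idle_config_le_1[OF assms \<open>t \<ge> 2 * b\<close> s])
      then show ?thesis by simp
    qed
    then have "?E (Suc t) (workload ?V) =
        ?E t (\<lambda>s. workload ?V s + real b * nonparticipant_service P s - real (card ?V))"
      unfolding expectation_config_Suc by (intro integral_cong_AE) (auto simp: AE_measure_pmf_iff)
    also have "\<dots> = ?E t (workload ?V) + real b * ?E t (nonparticipant_service P) - real (card ?V)"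
      by (simp add: int)
    finally show ?thesis by simp
  qed
  show ?thesis
    unfolding time_average_def
    by (rule average_tendsto_if_bounded_drift[where f = "\<lambda>t. ?E t (workload ?V)" and t\<^sub>0 = "2 * b",
          OF _ drift expectation_workload_le[OF _ assms(2)]])
      (use b_ge_1 in auto)
qed

lemma time_average_gain_tendsto:
  assumes "N \<le> b" "\<forall>w<N. s\<^sub>0 w \<le> b"
  shows "time_average P s\<^sub>0 (nonparticipant_gain P) \<longlonglongrightarrow> 0"
proof -
  have "measure_pmf.expectation (config P s\<^sub>0 t) (nonparticipant_gain P) = 0" if "t \<ge> 2 * b" for t
    using nonparticipant_gain_eq_0[OF card_idle_config_le_1[OF assms that]]
    by (intro integral_eq_zero_AE) (simp add: AE_measure_pmf_iff)
  then show ?thesis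
    unfolding time_average_def
    \<comment> \<open>Zero drift with \<open>f = 0\<close> serves only to discard the first
      \<open>2 * b\<close> steps.\<close>
    using average_tendsto_if_bounded_drift[of 1 "2 * b"
        "\<lambda>t. measure_pmf.expectation (config P s\<^sub>0 t) (nonparticipant_gain P)" 0 "\<lambda>_. 0" 0]
    by simp
qed

end

theorem theorem2:
  fixes N b :: nat and r \<delta> c m n \<tau> \<alpha> :: real
    and P :: "nat set" and s\<^sub>0 s\<^sub>0' :: configuration
  assumes "order_assignment N b r \<delta> c m n \<tau>"
    and "N \<le> b"
    and "0 \<le> \<alpha>" and "\<alpha> < 1"
    and "P \<subseteq> {..<N}" and "real (card P) = \<alpha> * real N"
    and "\<forall>w<N. s\<^sub>0 w \<le> b" and "\<forall>w<N. s\<^sub>0' w \<le> b"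
  shows "order_assignment.freeriding_benefit_defined N b r \<delta> \<tau> P s\<^sub>0 s\<^sub>0' \<and>
         order_assignment.freeriding_benefit N b r \<delta> c m n \<tau> \<alpha> P s\<^sub>0 s\<^sub>0' = 0"
proof -
  interpret order_assignment N b r \<delta> c m n \<tau> by fact
  note service = time_average_service_tendsto[OF assms(2,7), of P]
    and gain = time_average_gain_tendsto[OF assms(2,7), of P]
    and base = time_average_service_tendsto[OF assms(2,8), of "{}", unfolded nonparticipant_service_empty]
  have "real (card ({..<N} - P)) = real N - real (card P)"
    using assms(5) card_mono[OF _ assms(5)]
    by (simp add: card_Diff_subset finite_subset of_nat_diff)
  then have card: "real (card ({..<N} - P)) = (1 - \<alpha>) * real N"
    using assms(6) by (simp add: algebra_simps)
  \<comment> \<open>The number \<open>(1 - \<alpha>) * N\<close> of non-participants cancels,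
    leaving a service rate of \<open>1 / b\<close> per worker, as in the base model.\<close>
  have "utility_nonparticipant \<alpha> P s\<^sub>0 = (r - c * m) * n / real b"
    unfolding utility_nonparticipant_def long_run_average_def limI[OF service] limI[OF gain] card
    using assms(4) N_ge_1 by simp
  moreover have "utility_base s\<^sub>0' = (r - c * m) * n / real b"
    unfolding utility_base_def long_run_average_def limI[OF base]
    using N_ge_1 by simp
  ultimately show ?thesis
    using service gain base
    by (auto simp: freeriding_benefit_def freeriding_benefit_defined_def convergent_def)
qed

end
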